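(* Consider a min-plus linear system with random service process $S_\omega(\tau,t)$, $\omega\in\Omega$, i.e., $D(t)=\inf_{\tau\in[0,t]}\{A(\tau)+S(\tau,t)\}$ for all $t\ge0$ and any arrivals $A$. Let $A$ be a deterministic probe, let $\varepsilon\in(0,1]$, and let $B^{\varepsilon}(t)$ be the $(1-\varepsilon)$-quantile of the backlog $B(t)=A(t)-D(t)$ caused by this probe at time $t$. Then $$\mathcal{S}^{\varepsilon}(\tau,t)=A(t)-A(\tau)-B^{\varepsilon}(t),\qquad t\ge\tau\ge0,$$ satisfies $\mathsf{P}[S(\tau,t)\ge\mathcal{S}^{\varepsilon}(\tau,t)\ \forall\tau\in[0,t]]\ge1-\varepsilon$ for all $t\ge0$, and hence is a non-stationary service curve of the system: for any arrivals $A'$ with corresponding departures $D'$ and all $t\ge0$, $\mathsf{P}\bigl[D'(t)\ge\inf_{\tau\in[0,t]}\{A'(\tau)+\mathcal{S}^{\varepsilon}(\tau,t)\}\bigr]\ge1-\varepsilon$.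
   Context: A random service process $S(\tau,t)$, $t\ge\tau\ge0$, is a family of non-negative real random variables on a probability space $\Omega$ with $S(t,t)=0$ for all $t\ge0$; no stationarity or additivity is assumed. Cumulative arrivals (probes) are non-negative, non-decreasing functions with value $0$ at time $0$; $D(t)$ denotes cumulative departures. The $(1-\varepsilon)$-quantile of a non-negative random variable $X$ is $X^{\varepsilon}=\inf\{x\ge0:\mathsf{P}[X\le x]\ge1-\varepsilon\}$. All events whose probability is taken are assumed measurable (automatic in discrete time). *)

theory Defs
  imports "HOL-Probability.Probability"
begin

text \<open>
  Time is any linearly ordered type with a zero, restricted to \<open>t \<ge> 0\<close>: \<open>real\<close> gives continuous
  time and \<open>nat\<close> gives discrete time. All processes take the sample point as their first argument.
\<close>

definition arrivals :: "('t::{linorder,zero} \<Rightarrow> real) \<Rightarrow> bool" where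
  "arrivals A \<longleftrightarrow> (\<forall>t\<ge>0. 0 \<le> A t) \<and> mono_on {0..} A \<and> A 0 = 0"

definition arrival_process :: "'w measure \<Rightarrow> ('w \<Rightarrow> 't::{linorder,zero} \<Rightarrow> real) \<Rightarrow> bool" where
  "arrival_process M A \<longleftrightarrow>
     (\<forall>t\<ge>0. (\<lambda>\<omega>. A \<omega> t) \<in> borel_measurable M) \<and> (\<forall>\<omega>\<in>space M. arrivals (A \<omega>))"

definition service_process :: "'w measure \<Rightarrow> ('w \<Rightarrow> 't::{linorder,zero} \<Rightarrow> 't \<Rightarrow> real) \<Rightarrow> bool" where
  "service_process M S \<longleftrightarrow>
     (\<forall>\<tau>\<ge>0. \<forall>t\<ge>\<tau>. (\<lambda>\<omega>. S \<omega> \<tau> t) \<in> borel_measurable M \<and> (\<forall>\<omega>\<in>space M. 0 \<le> S \<omega> \<tau> t)) \<and>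
     (\<forall>t\<ge>0. \<forall>\<omega>\<in>space M. S \<omega> t t = 0)"

text \<open>
  A system maps, for each sample point \<open>\<omega>\<close>, an arrival function \<open>A\<close> to the departure function
  \<open>D \<omega> A\<close>. Since \<open>A\<close> and \<open>S\<close> are non-negative, the infimum below is over a non-empty
  set of reals that is bounded below.
\<close>

definition min_plus_linear_system ::
  "'w measure \<Rightarrow> ('w \<Rightarrow> 't::{linorder,zero} \<Rightarrow> 't \<Rightarrow> real) \<Rightarrow>
   ('w \<Rightarrow> ('t \<Rightarrow> real) \<Rightarrow> 't \<Rightarrow> real) \<Rightarrow> bool" where
  "min_plus_linear_system M S D \<longleftrightarrow>
     (\<forall>\<omega>\<in>space M. \<forall>A. arrivals A \<longrightarrow>
        (\<forall>t\<ge>0. D \<omega> A t = (INF \<tau>\<in>{0..t}. A \<tau> + S \<omega> \<tau> t)))"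

definition backlog ::
  "('w \<Rightarrow> ('t::{linorder,zero} \<Rightarrow> real) \<Rightarrow> 't \<Rightarrow> real) \<Rightarrow> ('t \<Rightarrow> real) \<Rightarrow> 't \<Rightarrow> 'w \<Rightarrow> real" where
  "backlog D A t \<omega> = A t - D \<omega> A t"

text \<open>The \<open>(1 - \<epsilon>)\<close>-quantile.\<close>

definition quantile :: "'w measure \<Rightarrow> real \<Rightarrow> ('w \<Rightarrow> real) \<Rightarrow> real" where
  "quantile M \<epsilon> X = Inf {x. 0 \<le> x \<and> \<P>(\<omega> in M. X \<omega> \<le> x) \<ge> 1 - \<epsilon>}"

definition probe_service_curve ::
  "'w measure \<Rightarrow> ('w \<Rightarrow> ('t::{linorder,zero} \<Rightarrow> real) \<Rightarrow> 't \<Rightarrow> real) \<Rightarrow> ('t \<Rightarrow> real) \<Rightarrow>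
   real \<Rightarrow> 't \<Rightarrow> 't \<Rightarrow> real" where
  "probe_service_curve M D A \<epsilon> \<tau> t = A t - A \<tau> - quantile M \<epsilon> (backlog D A t)"

text \<open>
  The arrivals may be random; deterministic arrivals are the processes constant in \<open>\<omega>\<close>.
  The event is required to be measurable since the infima over uncountably many \<open>\<tau>\<close> need not be,
  and \<open>measure M\<close> is 0 on sets that are not in \<open>sets M\<close>.
\<close>

definition nonstationary_service_curve ::
  "'w measure \<Rightarrow> ('w \<Rightarrow> ('t::{linorder,zero} \<Rightarrow> real) \<Rightarrow> 't \<Rightarrow> real) \<Rightarrow>
   real \<Rightarrow> ('t \<Rightarrow> 't \<Rightarrow> real) \<Rightarrow> bool" where
  "nonstationary_service_curve M D \<epsilon> C \<longleftrightarrow>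
     (\<forall>A. arrival_process M A \<longrightarrow>
        (\<forall>t\<ge>0.
           {\<omega> \<in> space M. D \<omega> (A \<omega>) t \<ge> (INF \<tau>\<in>{0..t}. A \<omega> \<tau> + C \<tau> t)} \<in> sets M \<longrightarrow>
           \<P>(\<omega> in M. D \<omega> (A \<omega>) t \<ge> (INF \<tau>\<in>{0..t}. A \<omega> \<tau> + C \<tau> t)) \<ge> 1 - \<epsilon>))"

end

theory Submission
  imports Defs
begin

text \<open>
  Since \<open>D(t)\<close> is the infimum of \<open>A(\<tau>) + S(\<tau>, t)\<close> over \<open>\<tau> \<le> t\<close>, the event that
  \<open>S(\<tau>, t) \<ge> A(t) - A(\<tau>) - q\<close> for all \<open>\<tau> \<le> t\<close> is exactly the event \<open>B(t) \<le> q\<close>. For the quantile \<open>q\<close> of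
  \<open>B(t)\<close> its probability is at least \<open>1 - \<epsilon>\<close>, as the infimum defining \<open>q\<close> is attained by right
  continuity of the distribution function. On this event the departures of every arrival function
  dominate the min-plus convolution with the curve.
\<close>

lemma (in prob_space) prob_le_quantile:
  assumes [measurable]: "X \<in> borel_measurable M" and "0 < \<epsilon>"
  shows "\<P>(\<omega> in M. X \<omega> \<le> quantile M \<epsilon> X) \<ge> 1 - \<epsilon>"
proof -
  define F where "F = cdf (distr M borel X)"
  define Q where "Q = {x. 0 \<le> x \<and> F x \<ge> 1 - \<epsilon>}"
  interpret F: real_distribution "distr M borel X"
    by (simp add: real_distribution_def real_distribution_axioms_def prob_space_distr)
  have F: "F x = \<P>(\<omega> in M. X \<omega> \<le> x)" for x
    unfolding F_def cdf_def by (subst measure_distr) (auto intro!: arg_cong[where f = prob])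
  have q: "quantile M \<epsilon> X = Inf Q"
    by (simp add: quantile_def Q_def F)
  \<comment> \<open>As \<open>F\<close> tends to 1 and \<epsilon> is positive, \<open>Q\<close> is
    non-empty; the real \<open>Inf\<close> of an empty set would say nothing.\<close>
  have "eventually (\<lambda>x. F x > 1 - \<epsilon>) at_top"
    using order_tendstoD(1)[OF F.cdf_lim_at_top_prob, of "1 - \<epsilon>"] assms(2) by (simp add: F_def)
  then have "eventually (\<lambda>x. x \<in> Q) at_top"
    using eventually_ge_at_top[of 0] by eventually_elim (simp add: Q_def)
  then have "Q \<noteq> {}"
    by (auto simp: eventually_at_top_linorder)
  \<comment> \<open>Monotonicity of \<open>F\<close> makes \<open>Q\<close> upward closed, so only
    the endpoint \<open>Inf Q\<close> is left to right continuity.\<close>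
  have above: "F x \<ge> 1 - \<epsilon>" if "x > Inf Q" for x
  proof -
    obtain y where "y \<in> Q" "y < x"
      using cInf_lessD[OF \<open>Q \<noteq> {}\<close> \<open>x > Inf Q\<close>] by auto
    then show ?thesis
      using F.cdf_nondecreasing[of y x] by (simp add: Q_def F_def)
  qed
  have "(F \<longlongrightarrow> F (Inf Q)) (at_right (Inf Q))"
    using F.cdf_is_right_cont[of "Inf Q"] by (simp add: F_def continuous_within)
  then have "1 - \<epsilon> \<le> F (Inf Q)"
    by (rule tendsto_lowerbound) (use above in \<open>auto intro: eventually_at_right_less eventually_mono\<close>)
  then show ?thesis
    by (simp add: F q)
qed

lemma min_plus_bdd_below:
  assumes "service_process M S" "arrivals A" "\<omega> \<in> space M"
  shows "bdd_below ((\<lambda>\<tau>. A \<tau> + S \<omega> \<tau> t) ` {0..t})"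
  using assms by (intro bdd_belowI2[where m = 0]) (auto simp: service_process_def arrivals_def)

text \<open>Being a lower bound of a family is the same as being below its infimum. This turns a
  condition on possibly uncountably many \<tau> into one on a single random variable, which settles
  measurability.\<close>

lemma service_ge_curve_iff_backlog_le:
  assumes "service_process M S" "min_plus_linear_system M S D" "arrivals A"
    and "\<omega> \<in> space M" "t \<ge> 0"
  shows "(\<forall>\<tau>\<in>{0..t}. S \<omega> \<tau> t \<ge> A t - A \<tau> - q) \<longleftrightarrow> backlog D A t \<omega> \<le> q"
proof -
  have "backlog D A t \<omega> \<le> q \<longleftrightarrow> A t - q \<le> (INF \<tau>\<in>{0..t}. A \<tau> + S \<omega> \<tau> t)"
    using assms by (auto simp: backlog_def min_plus_linear_system_def)
  also have "\<dots> \<longleftrightarrow> (\<forall>\<tau>\<in>{0..t}. A t - q \<le> A \<tau> + S \<omega> \<tau> t)"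
    using assms by (intro le_cINF_iff min_plus_bdd_below) auto
  finally show ?thesis
    by (auto simp: algebra_simps)
qed

text \<open>Monotonicity of the infimum for one sample point. \<open>C\<close> may be negative, so
  boundedness below has to be supplied for the real \<open>INF\<close> to be meaningful.\<close>

lemma departures_ge_convolution:
  assumes "min_plus_linear_system M S D"
    and "arrivals A" "\<omega> \<in> space M" "t \<ge> 0"
    and "bdd_below ((\<lambda>\<tau>. A \<tau> + C \<tau> t) ` {0..t})"
    and "\<And>\<tau>. \<tau> \<in> {0..t} \<Longrightarrow> C \<tau> t \<le> S \<omega> \<tau> t"
  shows "(INF \<tau>\<in>{0..t}. A \<tau> + C \<tau> t) \<le> D \<omega> A t"
proof -
  have "(INF \<tau>\<in>{0..t}. A \<tau> + C \<tau> t) \<le> (INF \<tau>\<in>{0..t}. A \<tau> + S \<omega> \<tau> t)"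
    by (rule cINF_mono) (use assms in \<open>auto intro!: bexI add_left_mono\<close>)
  then show ?thesis
    using assms by (simp add: min_plus_linear_system_def)
qed

theorem mainTheorem8:
  fixes M :: "'w measure"
    and S :: "'w \<Rightarrow> 't::{linorder,zero} \<Rightarrow> 't \<Rightarrow> real"
    and D :: "'w \<Rightarrow> ('t \<Rightarrow> real) \<Rightarrow> 't \<Rightarrow> real"
    and A :: "'t \<Rightarrow> real"
    and \<epsilon> :: real
  assumes "prob_space M"
    and "service_process M S"
    and "min_plus_linear_system M S D"
    and "arrivals A"
    and "\<And>t. t \<ge> 0 \<Longrightarrow> backlog D A t \<in> borel_measurable M"
    and "0 < \<epsilon>" and "\<epsilon> \<le> 1"
  shows "(\<forall>t\<ge>0. \<P>(\<omega> in M. \<forall>\<tau>\<in>{0..t}. S \<omega> \<tau> t \<ge> probe_service_curve M D A \<epsilon> \<tau> t) \<ge> 1 - \<epsilon>)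
    \<and> nonstationary_service_curve M D \<epsilon> (probe_service_curve M D A \<epsilon>)"
proof -
  interpret prob_space M by fact
  let ?C = "probe_service_curve M D A \<epsilon>"
  let ?E = "\<lambda>t. {\<omega> \<in> space M. \<forall>\<tau>\<in>{0..t}. S \<omega> \<tau> t \<ge> ?C \<tau> t}"
  have prob_E: "1 - \<epsilon> \<le> prob (?E t)" if "t \<ge> 0" for t
  proof -
    have "?E t = {\<omega> \<in> space M. backlog D A t \<omega> \<le> quantile M \<epsilon> (backlog D A t)}"
      using service_ge_curve_iff_backlog_le[OF assms(2-4) _ that]
      unfolding probe_service_curve_def by blast
    then show ?thesis
      using prob_le_quantile[OF assms(5)[OF that] assms(6)] by simp
  qed
  let ?G = "\<lambda>A' t. {\<omega> \<in> space M. D \<omega> (A' \<omega>) t \<ge> (INF \<tau>\<in>{0..t}. A' \<omega> \<tau> + ?C \<tau> t)}"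
  have "1 - \<epsilon> \<le> prob (?G A' t)"
    if A': "arrival_process M A'" and t: "t \<ge> 0" and G: "?G A' t \<in> sets M" for A' t
  proof -
    have "\<omega> \<in> ?G A' t" if \<omega>: "\<omega> \<in> ?E t" for \<omega>
    proof -
      have arr: "arrivals (A' \<omega>)"
        using A' \<omega> by (auto simp: arrival_process_def)
      \<comment> \<open>The probe is non-decreasing, so the curve never drops below minus the
        backlog quantile.\<close>
      have "- quantile M \<epsilon> (backlog D A t) \<le> A' \<omega> \<tau> + ?C \<tau> t" if "\<tau> \<in> {0..t}" for \<tau>
      proof -
        have "0 \<le> A' \<omega> \<tau>" "A \<tau> \<le> A t"
          using arr assms(4) that t by (auto simp: arrivals_def mono_on_def)
        then show ?thesis
          by (simp add: probe_service_curve_def)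
      qed
      then have "bdd_below ((\<lambda>\<tau>. A' \<omega> \<tau> + ?C \<tau> t) ` {0..t})"
        by (rule bdd_belowI2)
      then show ?thesis
        using departures_ge_convolution[OF assms(3) arr _ t, where C = ?C] \<omega> by auto
    qed
    \<comment> \<open>The inclusion holds pointwise and \<open>?E t\<close> does not involve
      \<open>A'\<close>, so random arrivals may depend on the service in any way.\<close>
    then have "prob (?E t) \<le> prob (?G A' t)"
      by (intro finite_measure_mono G) blast
    with prob_E[OF t] show ?thesis
      by linarith
  qed
  with prob_E show ?thesis
    by (auto simp: nonstationary_service_curve_def)
qed

end
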